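(* Let $\theta\in(0,1)$ and consider the initial value problem $$\mathbf y'(t)=\mathbf A_\theta\,\mathbf y(t),\qquad \mathbf y(0)=\mathbf y^0>\mathbf 0,\qquad \mathbf A_\theta=\begin{pmatrix}-\theta & 1-\theta\\ \theta & -(1-\theta)\end{pmatrix}.$$ Let $\mathbf g:\mathbb R^2_{>0}\to\mathbb R^2_{>0}$ be a $\mathcal C^2$ map such that every positive steady state of the differential equation (i.e. every $\mathbf v\in\mathbb R^2_{>0}$ with $\mathbf A_\theta\mathbf v=\mathbf 0$) is a fixed point of $\mathbf g$. Assume that, for every starting value in $\mathbb R^2_{>0}$, the iterates generated by $\mathbf y^{n+1}=\mathbf g(\mathbf y^n)$ satisfy $\lVert \mathbf y^{n+1}\rVert_1=\lVert\mathbf y^n\rVert_1$ for all $n\in\mathbb N_0$. Let $\mathbf y^*$ be the unique positive steady state of the initial value problem, i.e. the unique $\mathbf y^*\in\mathbb R^2_{>0}$ with $\mathbf A_\theta\mathbf y^*=\mathbf 0$ and $\lVert\mathbf y^*\rVert_1=\lVert\mathbf y^0\rVert_1$. Then the spectrum of the Jacobian $\mathbf D\mathbf g(\mathbf y^* )$ is $\sigma(\mathbf D\mathbf g(\mathbf y^* ))=\{1,R\}$ with some $R\in\mathbb R$. Furthermore, in the normalization $\lVert\mathbf y^0\rVert_1=1$ (so that $\mathbf y^*=(1-\theta,\theta)^\intercal$), if $R<0$, then the method generated by $\mathbf g$ is overshooting the steady state of the initial value problem.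
   Context: Here $\mathbb R^2_{>0}$ is the set of vectors in $\mathbb R^2$ with both components strictly positive, $\mathbf y>\mathbf 0$ is meant componentwise, and $\lVert\mathbf y\rVert_1=|y_1|+|y_2|$. The exact solution of the initial value problem conserves $y_1+y_2$. In $\sigma(\mathbf D\mathbf g(\mathbf y^* ))=\{1,R\}$, $R$ denotes the second eigenvalue (counted with multiplicity), so $R=1$ is allowed. The method generated by $\mathbf g$ is the one-step method $\mathbf y^{n+1}=\mathbf g(\mathbf y^n)$; in particular $\mathbf y^1=\mathbf g(\mathbf y^0)$. Definition (overshooting). The method is called *not overshooting* the steady state if for every initial state of the form $\mathbf y^0=(1-\epsilon,\epsilon)^\intercal$ with $\epsilon\in(0,1)$ the following holds: if $\epsilon<\theta$, then $y^1_2<\theta$ and $y^1_1>1-\theta$; and if $\epsilon>\theta$, then $y^1_2>\theta$ and $y^1_1<1-\theta$. Otherwise the method is called *overshooting* the steady state. *)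

theory Defs
  imports "HOL-Analysis.Analysis" "Jordan_Normal_Form.Spectral_Radius"
begin

no_notation Matrix.vec_index (infixl "$" 100)

definition pos_quadrant :: "(real^2) set" where
  "pos_quadrant = {y. \<forall>i. 0 < y $ i}"

definition norm1 :: "real^2 \<Rightarrow> real" where
  "norm1 y = (\<Sum>i\<in>UNIV. \<bar>y $ i\<bar>)"

definition A_theta :: "real \<Rightarrow> real^2^2" where
  "A_theta \<theta> = vector [vector [- \<theta>, 1 - \<theta>], vector [\<theta>, - (1 - \<theta>)]]"

definition pos_steady_state :: "real \<Rightarrow> real^2 \<Rightarrow> bool" where
  "pos_steady_state \<theta> v \<longleftrightarrow> v \<in> pos_quadrant \<and> A_theta \<theta> *v v = 0"

text \<open>Intended for open \<open>S\<close>: \<open>f'\<close> and \<open>f''\<close> are the first and second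
  Frechet derivatives.\<close>

definition C2_on :: "(real^2 \<Rightarrow> real^2) \<Rightarrow> (real^2) set \<Rightarrow> bool" where
  "C2_on f S \<longleftrightarrow>
     (\<exists>(f' :: real^2 \<Rightarrow> ((real^2) \<Rightarrow>\<^sub>L (real^2)))
       (f'' :: real^2 \<Rightarrow> ((real^2) \<Rightarrow>\<^sub>L ((real^2) \<Rightarrow>\<^sub>L (real^2)))).
        (\<forall>x\<in>S. (f has_derivative blinfun_apply (f' x)) (at x)) \<and>
        (\<forall>x\<in>S. (f' has_derivative blinfun_apply (f'' x)) (at x)) \<and>
        continuous_on S f'')"

text \<open>The Jacobian as a complex matrix, since the spectrum is a priori a subset of the
  complex numbers.\<close>

definition complex_jacobian :: "(real^2 \<Rightarrow> real^2) \<Rightarrow> real^2 \<Rightarrow> complex mat" where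
  "complex_jacobian f y = (let J = jacobian f (at y) in
     mat_of_rows_list 2
       [[complex_of_real (J $ 1 $ 1), complex_of_real (J $ 1 $ 2)],
        [complex_of_real (J $ 2 $ 1), complex_of_real (J $ 2 $ 2)]])"

text \<open>The eigenvalues counted with algebraic multiplicity.\<close>

definition eigenvalue_mset :: "complex mat \<Rightarrow> complex multiset" where
  "eigenvalue_mset M = proots (char_poly M)"

definition not_overshooting :: "real \<Rightarrow> (real^2 \<Rightarrow> real^2) \<Rightarrow> bool" where
  "not_overshooting \<theta> g \<longleftrightarrow>
     (\<forall>\<epsilon>. 0 < \<epsilon> \<and> \<epsilon> < 1 \<longrightarrow>
        (let y1 = g (vector [1 - \<epsilon>, \<epsilon>]) in
          (\<epsilon> < \<theta> \<longrightarrow> y1 $ 2 < \<theta> \<and> y1 $ 1 > 1 - \<theta>) \<and>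
          (\<epsilon> > \<theta> \<longrightarrow> y1 $ 2 > \<theta> \<and> y1 $ 1 < 1 - \<theta>)))"

definition overshooting :: "real \<Rightarrow> (real^2 \<Rightarrow> real^2) \<Rightarrow> bool" where
  "overshooting \<theta> g \<longleftrightarrow> \<not> not_overshooting \<theta> g"

lemma pos_steady_state_iff:
  "pos_steady_state \<theta> v \<longleftrightarrow> 0 < v $ 1 \<and> 0 < v $ 2 \<and> \<theta> * v $ 1 = (1 - \<theta>) * v $ 2"
proof -
  have "A_theta \<theta> *v v = 0 \<longleftrightarrow> \<theta> * v $ 1 = (1 - \<theta>) * v $ 2"
    unfolding Finite_Cartesian_Product.vec_eq_iff forall_2
    by (simp add: A_theta_def matrix_vector_mult_def sum_2) (auto simp: algebra_simps)
  then show ?thesis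
    by (simp add: pos_steady_state_def pos_quadrant_def forall_2)
qed

lemma pos_steady_state_unique:
  assumes \<theta>: "0 < \<theta>" "\<theta> < 1" and y0: "y0 \<in> pos_quadrant"
  shows "\<exists>!v. pos_steady_state \<theta> v \<and> norm1 v = norm1 y0"
proof
  define s where "s = norm1 y0"
  have s: "s > 0"
    using y0 by (auto simp: s_def norm1_def pos_quadrant_def sum_2 forall_2)
  let ?v = "vector [(1 - \<theta>) * s, \<theta> * s] :: real^2"
  have pos: "0 < (1 - \<theta>) * s" "0 < \<theta> * s"
    using \<theta> s by simp_all
  have "norm1 ?v = (1 - \<theta>) * s + \<theta> * s"
    using pos by (simp only: norm1_def sum_2 vector_2 abs_of_pos)
  also have "\<dots> = s"
    by (simp add: algebra_simps)
  finally show "pos_steady_state \<theta> ?v \<and> norm1 ?v = norm1 y0"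
    using pos by (simp add: pos_steady_state_iff s_def)
  fix v :: "real^2"
  assume v: "pos_steady_state \<theta> v \<and> norm1 v = norm1 y0"
  then have 1: "\<theta> * v $ 1 = (1 - \<theta>) * v $ 2" and 2: "v $ 1 + v $ 2 = s"
    by (auto simp: pos_steady_state_iff norm1_def sum_2 s_def)
  from 1 have "v $ 2 = \<theta> * (v $ 1 + v $ 2)"
    by (simp add: algebra_simps)
  then have "v $ 2 = \<theta> * s"
    by (simp only: 2)
  with 2 show "v = ?v"
    by (simp add: Finite_Cartesian_Product.vec_eq_iff forall_2 algebra_simps)
qed

end

theory Submission
  imports Defs
begin

text \<open>Conservation of \<open>y\<^sub>1 + y\<^sub>2\<close> forces the columns of the Jacobian to sum to \<open>1\<close>, so its
  characteristic polynomial is \<open>(x - 1) (x - R)\<close> with \<open>R = J\<^sub>2\<^sub>2 - J\<^sub>2\<^sub>1\<close>. This \<open>R\<close> is the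
  derivative at \<open>\<epsilon> = \<theta>\<close> of the second component of \<open>\<epsilon> \<mapsto> g (1 - \<epsilon>, \<epsilon>)\<close>, a function
  that takes the value \<open>\<theta>\<close> there; if \<open>R < 0\<close>, it drops below \<open>\<theta>\<close> immediately to the right.\<close>

lemma char_poly_2x2:
  fixes a b c d :: "'a::comm_ring_1"
  shows "char_poly (mat_of_rows_list 2 [[a, b], [c, d]]) = [:a * d - b * c, - (a + d), 1:]"
proof -
  let ?M = "char_poly_matrix (mat_of_rows_list 2 [[a, b], [c, d]])"
  have M: "?M \<in> carrier_mat 2 2"
    by (intro char_poly_matrix_closed) (simp add: mat_of_rows_list_def numeral_2_eq_2)
  \<comment> \<open>The minors of the Laplace expansion along column \<open>0\<close> have size 1 by
    1, so \<open>det_single\<close> evaluates them.\<close>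
  have del: "mat_delete ?M i 0 \<in> carrier_mat 1 1" for i
    using mat_delete_carrier[OF M, of i 0] by simp
  have "det ?M = ?M $$ (0, 0) * ?M $$ (1, 1) - ?M $$ (1, 0) * ?M $$ (0, 1)"
    using M unfolding laplace_expansion_column[OF M pos2] cofactor_def det_single[OF del]
    by (auto simp: mat_delete_def numeral_2_eq_2)
  then show ?thesis
    by (simp add: char_poly_def)
       (simp add: char_poly_matrix_def mat_of_rows_list_def numeral_2_eq_2 algebra_simps)
qed

text \<open>Substituting \<open>a = 1 - c\<close> and \<open>b = 1 - d\<close> gives trace
  \<open>1 + (d - c)\<close> and determinant \<open>d - c\<close>. The multiset records the double
  eigenvalue when \<open>d - c = 1\<close>, where the set collapses.\<close>

lemma eigenvalues_2x2_col_sum_1: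
  fixes a b c d :: complex
  defines "M \<equiv> mat_of_rows_list 2 [[a, b], [c, d]]"
  assumes "a + c = 1" and "b + d = 1"
  shows "eigenvalue_mset M = {#1, d - c#}" and "spectrum M = {1, d - c}"
proof -
  have ab: "a = 1 - c" "b = 1 - d"
    using assms by (auto simp: algebra_simps)
  then have cp: "char_poly M = [:- 1, 1:] * [:- (d - c), 1:]"
    unfolding M_def char_poly_2x2 ab by (simp add: algebra_simps)
  show "eigenvalue_mset M = {#1, d - c#}"
    unfolding eigenvalue_mset_def cp by (subst proots_mult) auto
  have "M \<in> carrier_mat 2 2"
    by (simp add: M_def mat_of_rows_list_def numeral_2_eq_2)
  \<comment> \<open>Keeping the product of linear factors unexpanded lets \<open>poly_mult\<close>
    read off the roots.\<close>
  then show "spectrum M = {1, d - c}"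
    by (auto simp: spectrum_def eigenvalue_root_char_poly cp poly_mult eq_diff_eq add_eq_0_iff
        simp del: mult_pCons_left mult_pCons_right)
qed

lemma open_pos_quadrant: "open pos_quadrant"
proof -
  have "pos_quadrant = {y. 0 < y $ 1} \<inter> {y. 0 < y $ 2}"
    by (auto simp: pos_quadrant_def forall_2)
  moreover have "open {y :: real^2. 0 < y $ i}" for i
    by (intro open_Collect_less continuous_intros)
  ultimately show ?thesis
    by (metis open_Int)
qed

lemma norm1_pos_quadrant: "y \<in> pos_quadrant \<Longrightarrow> norm1 y = y $ 1 + y $ 2"
  by (simp add: norm1_def sum_2 pos_quadrant_def forall_2)

lemma C2_on_has_derivative_jacobian:
  assumes "C2_on f S" and "x \<in> S"
  shows "(f has_derivative (\<lambda>h. jacobian f (at x) *v h)) (at x)"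
  using assms jacobian_works[of f "at x"] unfolding C2_on_def differentiable_def by blast

text \<open>The conservation law equates two differentiable functions near \<open>y\<close>, so
  their derivatives agree; evaluating these at the \<open>j\<close>-th basis vector isolates column
  \<open>j\<close>.\<close>

lemma jacobian_col_sum_1:
  fixes g :: "real^2 \<Rightarrow> real^2"
  assumes D: "(g has_derivative (\<lambda>h. J *v h)) (at y)" and S: "open S" "y \<in> S"
    and sum: "\<And>z. z \<in> S \<Longrightarrow> g z $ 1 + g z $ 2 = z $ 1 + z $ 2"
  shows "J $ 1 $ j + J $ 2 $ j = 1"
proof -
  have "((\<lambda>z. g z $ 1 + g z $ 2) has_derivative (\<lambda>h. (J *v h) $ 1 + (J *v h) $ 2)) (at y)"
    by (intro has_derivative_add bounded_linear.has_derivative[OF bounded_linear_vec_nth] D)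
  then have "((\<lambda>z. z $ 1 + z $ 2) has_derivative (\<lambda>h. (J *v h) $ 1 + (J *v h) $ 2)) (at y)"
    by (rule has_derivative_transform_within_open[OF _ S sum])
  moreover have "((\<lambda>z::real^2. z $ 1 + z $ 2) has_derivative (\<lambda>h. h $ 1 + h $ 2)) (at y)"
    by (intro has_derivative_add bounded_linear.has_derivative[OF bounded_linear_vec_nth]
        has_derivative_ident)
  ultimately have "(\<lambda>h. (J *v h) $ 1 + (J *v h) $ 2) = (\<lambda>h. h $ 1 + h $ 2)"
    by (rule has_derivative_unique)
  from fun_cong[OF this, of "axis j 1"] show ?thesis
    using exhaust_2[of j] by (auto simp: matrix_vector_mult_def sum_2 axis_def)
qed

lemma overshooting_if_neg:
  assumes \<theta>: "0 < \<theta>" "\<theta> < 1"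
    and D: "(g has_derivative (\<lambda>h. J *v h)) (at (vector [1 - \<theta>, \<theta>]))"
    and fix_pt: "g (vector [1 - \<theta>, \<theta>]) = vector [1 - \<theta>, \<theta>]"
    and neg: "J $ 2 $ 2 - J $ 2 $ 1 < 0"
  shows "overshooting \<theta> g"
proof -
  define p :: "real \<Rightarrow> real^2" where "p \<epsilon> = vector [1 - \<epsilon>, \<epsilon>]" for \<epsilon>
  define w :: "real^2" where "w = vector [- 1, 1]"
  \<comment> \<open>The starting values form an affine line with direction \<open>w\<close>, so the
    chain rule gives the slope \<open>(J *v w) $ 2\<close>, which is
    \<open>J $ 2 $ 2 - J $ 2 $ 1\<close>.\<close>
  have p: "p = (\<lambda>\<epsilon>. vector [1, 0] + \<epsilon> *\<^sub>R w)"
    by (simp add: p_def w_def fun_eq_iff Finite_Cartesian_Product.vec_eq_iff forall_2)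
  have "(p has_derivative (\<lambda>t. t *\<^sub>R w)) (at \<theta>)"
    unfolding p by (auto intro!: derivative_eq_intros)
  then have "((\<lambda>\<epsilon>. g (p \<epsilon>)) has_derivative (\<lambda>t. J *v (t *\<^sub>R w))) (at \<theta>)"
    by (rule has_derivative_compose) (use D in \<open>simp add: p_def\<close>)
  then have "((\<lambda>\<epsilon>. g (p \<epsilon>) $ 2) has_derivative (\<lambda>t. (J *v (t *\<^sub>R w)) $ 2)) (at \<theta>)"
    by (rule bounded_linear.has_derivative[OF bounded_linear_vec_nth])
  moreover have "(\<lambda>t. (J *v (t *\<^sub>R w)) $ 2) = (*) (J $ 2 $ 2 - J $ 2 $ 1)"
    by (simp add: fun_eq_iff matrix_vector_mult_def sum_2 w_def algebra_simps)
  ultimately have "DERIV (\<lambda>\<epsilon>. g (p \<epsilon>) $ 2) \<theta> :> J $ 2 $ 2 - J $ 2 $ 1"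
    by (simp add: has_field_derivative_def)
  from DERIV_neg_dec_right[OF this neg] obtain \<delta>
    where \<delta>: "\<delta> > 0" "\<And>h. 0 < h \<Longrightarrow> h < \<delta> \<Longrightarrow> g (p (\<theta> + h)) $ 2 < g (p \<theta>) $ 2"
    by blast
  \<comment> \<open>Halving the minimum keeps \<open>h\<close> strictly inside the range of decrease
    and \<open>\<theta> + h\<close> strictly below \<open>1\<close>.\<close>
  define h where "h = min \<delta> (1 - \<theta>) / 2"
  have h: "0 < h" "h < \<delta>" "\<theta> + h < 1"
    using \<delta>(1) \<theta> by (auto simp: h_def min_def field_simps)
  have "g (p (\<theta> + h)) $ 2 < \<theta>"
    using \<delta>(2)[OF h(1,2)] fix_pt by (simp add: p_def)
  \<comment> \<open>The start \<open>\<epsilon> = \<theta> + h\<close> violates the clause of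
    \<open>not_overshooting\<close> for \<open>\<epsilon> > \<theta>\<close>.\<close>
  then show ?thesis
    unfolding overshooting_def not_overshooting_def Let_def p_def
    using h \<theta> by (auto intro!: exI[of _ "\<theta> + h"])
qed

theorem theorem1:
  fixes \<theta> :: real and g :: "real^2 \<Rightarrow> real^2" and y0 ystar :: "real^2"
  assumes "0 < \<theta>" and "\<theta> < 1"
    and "y0 \<in> pos_quadrant"
    and "g ` pos_quadrant \<subseteq> pos_quadrant"
    and "C2_on g pos_quadrant"
    and "\<And>v. pos_steady_state \<theta> v \<Longrightarrow> g v = v"
    and "\<And>y n. y \<in> pos_quadrant \<Longrightarrow> norm1 ((g ^^ Suc n) y) = norm1 ((g ^^ n) y)"
    and "pos_steady_state \<theta> ystar" and "norm1 ystar = norm1 y0"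
  shows "\<exists>R::real.
    spectrum (complex_jacobian g ystar) = {1, complex_of_real R} \<and>
    eigenvalue_mset (complex_jacobian g ystar) = {#1, complex_of_real R#} \<and>
    (norm1 y0 = 1 \<longrightarrow>
      ystar = vector [1 - \<theta>, \<theta>] \<and> (R < 0 \<longrightarrow> overshooting \<theta> g))"
proof -
  define J where "J = jacobian g (at ystar)"
  have ystar: "ystar \<in> pos_quadrant"
    using assms(8) by (simp add: pos_steady_state_def)
  have D: "(g has_derivative (\<lambda>h. J *v h)) (at ystar)"
    unfolding J_def by (rule C2_on_has_derivative_jacobian[OF assms(5) ystar])
  \<comment> \<open>The first step \<open>n = 0\<close> from an arbitrary start gives conservation
    pointwise; both \<open>y\<close> and \<open>g y\<close> are positive, so \<open>norm1\<close> is
    the plain sum.\<close>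
  have "g y $ 1 + g y $ 2 = y $ 1 + y $ 2" if "y \<in> pos_quadrant" for y
    using assms(7)[OF that, of 0] assms(4) that by (simp add: norm1_pos_quadrant image_subset_iff)
  then have col: "J $ 1 $ j + J $ 2 $ j = 1" for j
    by (rule jacobian_col_sum_1[OF D open_pos_quadrant ystar])
  define R where "R = J $ 2 $ 2 - J $ 2 $ 1"
  have "complex_of_real (J $ 1 $ j) + complex_of_real (J $ 2 $ j) = 1" for j
    by (simp only: of_real_add[symmetric] col of_real_1)
  note eig = eigenvalues_2x2_col_sum_1[OF this[of 1] this[of 2]]
  have "spectrum (complex_jacobian g ystar) = {1, complex_of_real R}"
    and "eigenvalue_mset (complex_jacobian g ystar) = {#1, complex_of_real R#}"
    using eig by (simp_all add: complex_jacobian_def Let_def J_def[symmetric] R_def)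
  moreover have "ystar = vector [1 - \<theta>, \<theta>]" and "R < 0 \<longrightarrow> overshooting \<theta> g"
    if "norm1 y0 = 1"
  proof -
    have "ystar $ 1 + ystar $ 2 = 1"
      using assms(9) that ystar by (simp add: norm1_pos_quadrant)
    moreover have "\<theta> * ystar $ 1 = (1 - \<theta>) * ystar $ 2"
      using assms(8) by (simp add: pos_steady_state_iff)
    \<comment> \<open>This is the steady-state equation with \<open>\<theta> * ystar $ 2\<close>
      added to both sides; total mass \<open>1\<close> then yields
      \<open>ystar $ 2 = \<theta>\<close>.\<close>
    then have "ystar $ 2 = \<theta> * (ystar $ 1 + ystar $ 2)"
      by (simp add: algebra_simps)
    ultimately show eq: "ystar = vector [1 - \<theta>, \<theta>]"
      by (simp add: Finite_Cartesian_Product.vec_eq_iff forall_2)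
    show "R < 0 \<longrightarrow> overshooting \<theta> g"
      using overshooting_if_neg[of \<theta> g J] assms(1,2) D assms(6)[OF assms(8)]
      by (simp add: eq R_def)
  qed
  ultimately show ?thesis
    by blast
qed

end
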